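(* Let $d\geq1$ be an integer. For all bounded subsets $X\subseteq\mathbb{R}^d$, all $\boldsymbol{\sigma}=(\sigma_1,\ldots,\sigma_d)\in(0,\infty)^d$, and all $0<\varepsilon\leq 1$ we have $$\mathcal{H}\bigl(\mathrm{Id}: H_{\boldsymbol{\sigma}}(X)\to\ell_\infty(X),\,\varepsilon\bigr)\leq\mathcal{N}(D_{\boldsymbol{\sigma}}X,1)\cdot\mathcal{H}\bigl(\mathrm{Id}: H_1(B_2^d)\to\ell_\infty(B_2^d),\,\varepsilon\bigr),$$ where the covering number $\mathcal{N}(D_{\boldsymbol{\sigma}}X,1)$ of $D_{\boldsymbol{\sigma}}X\subseteq\mathbb{R}^d$ is with respect to the Euclidean norm on $\mathbb{R}^d$.
   Context: $B_2^d\subseteq\mathbb{R}^d$ denotes the closed Euclidean unit ball and $\|\cdot\|_{\ell_2^d}$ the Euclidean norm. For $\boldsymbol{\sigma}=(\sigma_1,\ldots,\sigma_d)\in(0,\infty)^d$, $D_{\boldsymbol{\sigma}}(x_1,\ldots,x_d)=(\sigma_1x_1,\ldots,\sigma_dx_d)$, and $H_{\boldsymbol{\sigma}}(X)$ is the reproducing kernel Hilbert space (of real-valued functions on $X$) of the anisotropic Gaussian kernel $k_{\boldsymbol{\sigma}}(x,x')=\exp(-\|D_{\boldsymbol{\sigma}}x-D_{\boldsymbol{\sigma}}x'\|_{\ell_2^d}^2)$, $x,x'\in X$. $H_1(B_2^d)$ is the reproducing kernel Hilbert space over $B_2^d$ of the isotropic Gaussian kernel $k_1(x,x')=\exp(-\|x-x'\|_{\ell_2^d}^2)$.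 $\ell_\infty(X)$ is the Banach space of bounded functions $f:X\to\mathbb{R}$ with the supremum norm, and $\mathrm{Id}$ is the canonical embedding $f\mapsto f$. For a bounded subset $A$ of a Banach space $E$ with closed unit ball $B_E$, the covering numbers are $\mathcal{N}(A,\varepsilon)=\min\{n\in\{1,2,\ldots\}: \exists x_1,\ldots,x_n\in E \text{ with } A\subseteq\bigcup_{i=1}^n (x_i+\varepsilon B_E)\}$, $\varepsilon>0$. For a bounded linear operator $T:E\to F$ between Banach spaces, the log-covering numbers are $\mathcal{H}(T,\varepsilon)=\log\mathcal{N}(T B_E,\varepsilon)$, with $\log$ the natural logarithm. *)

theory Defs
  imports "HOL-Analysis.Analysis"
begin

subsection \<open>Covering numbers\<close>

text \<open>
  Covering numbers by closed balls with centres in the whole ambient space. In a normed space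
  \<open>E\<close> with its norm metric, the closed ball \<open>mcball_of E x \<epsilon>\<close> is \<open>x + \<epsilon> B\<^sub>E\<close>. The centres need not
  be distinct, and the value is at least 1 even for the empty set. The infimum over the empty set
  is \<open>\<infinity>\<close>; otherwise it is a minimum.
\<close>

definition covering_number :: "'a metric \<Rightarrow> 'a set \<Rightarrow> real \<Rightarrow> enat" where
  "covering_number E A \<epsilon> =
     Inf {enat n | n. 1 \<le> n \<and>
       (\<exists>x :: nat \<Rightarrow> 'a. (\<forall>i<n. x i \<in> mspace E) \<and> A \<subseteq> (\<Union>i<n. mcball_of E (x i) \<epsilon>))}"

fun ln_enat :: "enat \<Rightarrow> ereal" where
  "ln_enat (enat n) = ereal (ln (real n))"
| "ln_enat \<infinity> = \<infinity>"

text \<open>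
  Log-covering number of an operator \<open>T\<close> from a normed space, given by its carrier \<open>E\<close> and norm
  \<open>nrm\<close>, into a normed space with norm metric \<open>F\<close>.
\<close>

definition log_covering_number ::
    "('a \<Rightarrow> 'b) \<Rightarrow> 'a set \<Rightarrow> ('a \<Rightarrow> real) \<Rightarrow> 'b metric \<Rightarrow> real \<Rightarrow> ereal" where
  "log_covering_number T E nrm F \<epsilon> =
     ln_enat (covering_number F (T ` {f \<in> E. nrm f \<le> 1}) \<epsilon>)"


subsection \<open>Reproducing kernel Hilbert spaces\<close>

text \<open>
  Functions on a set \<open>X\<close> are represented by elements of \<^term>\<open>extensional X\<close>. Accordingly
  \<open>\<ell>\<^sub>\<infinity>(X)\<close> is the library's space of bounded functions with the supremum metric.
\<close>

definition linf :: "'a set \<Rightarrow> ('a \<Rightarrow> real) metric" where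
  "linf X = funspace X euclidean_metric"

definition ip_norm :: "('b \<Rightarrow> 'b \<Rightarrow> real) \<Rightarrow> 'b \<Rightarrow> real" where
  "ip_norm ip f = sqrt (ip f f)"

text \<open>
  A real Hilbert space of functions on \<open>X\<close> with the pointwise vector space operations; \<open>ip\<close> is
  only relevant on \<open>H\<close>.
\<close>

locale hilbert_function_space =
  fixes X :: "'a set"
    and H :: "('a \<Rightarrow> real) set"
    and ip :: "('a \<Rightarrow> real) \<Rightarrow> ('a \<Rightarrow> real) \<Rightarrow> real"
  assumes functions_on: "H \<subseteq> extensional X"
    and zero_closed: "(\<lambda>x\<in>X. 0) \<in> H"
    and add_closed: "\<lbrakk>f \<in> H; g \<in> H\<rbrakk> \<Longrightarrow> (\<lambda>x\<in>X. f x + g x) \<in> H"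
    and scale_closed: "f \<in> H \<Longrightarrow> (\<lambda>x\<in>X. c * f x) \<in> H"
    and ip_commute: "\<lbrakk>f \<in> H; g \<in> H\<rbrakk> \<Longrightarrow> ip f g = ip g f"
    and ip_add_left: "\<lbrakk>f \<in> H; g \<in> H; h \<in> H\<rbrakk> \<Longrightarrow> ip (\<lambda>x\<in>X. f x + g x) h = ip f h + ip g h"
    and ip_scale_left: "\<lbrakk>f \<in> H; g \<in> H\<rbrakk> \<Longrightarrow> ip (\<lambda>x\<in>X. c * f x) g = c * ip f g"
    and ip_nonneg: "f \<in> H \<Longrightarrow> 0 \<le> ip f f"
    and ip_definite: "\<lbrakk>f \<in> H; ip f f = 0\<rbrakk> \<Longrightarrow> f = (\<lambda>x\<in>X. 0)"
    and complete: "Metric_space.mcomplete H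
      (\<lambda>f g. ip_norm ip (\<lambda>x\<in>X. f x - g x))"

text \<open>
  \<open>H\<close> with inner product \<open>ip\<close> is the reproducing kernel Hilbert space over \<open>X\<close> of the kernel \<open>k\<close>.
  By the Moore--Aronszajn theorem it exists (for positive semidefinite \<open>k\<close>) and is determined by
  \<open>X\<close> and \<open>k\<close>.
\<close>

locale rkhs = hilbert_function_space X H ip
  for X :: "'a set" and k :: "'a \<Rightarrow> 'a \<Rightarrow> real"
    and H :: "('a \<Rightarrow> real) set" and ip :: "('a \<Rightarrow> real) \<Rightarrow> ('a \<Rightarrow> real) \<Rightarrow> real" +
  assumes kernel_section: "x \<in> X \<Longrightarrow> (\<lambda>y\<in>X. k y x) \<in> H"
    and reproducing: "\<lbrakk>f \<in> H; x \<in> X\<rbrakk> \<Longrightarrow> ip f (\<lambda>y\<in>X. k y x) = f x"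


subsection \<open>Gaussian kernels\<close>

definition diag_scale :: "real ^ 'n \<Rightarrow> real ^ 'n \<Rightarrow> real ^ 'n" where
  "diag_scale \<sigma> x = (\<chi> i. \<sigma> $ i * x $ i)"

definition aniso_gauss_kernel :: "real ^ 'n \<Rightarrow> real ^ 'n \<Rightarrow> real ^ 'n \<Rightarrow> real" where
  "aniso_gauss_kernel \<sigma> x y = exp (- (norm (diag_scale \<sigma> x - diag_scale \<sigma> y))\<^sup>2)"

definition gauss_kernel :: "real ^ 'n \<Rightarrow> real ^ 'n \<Rightarrow> real" where
  "gauss_kernel x y = exp (- (norm (x - y))\<^sup>2)"

end

theory Submission
  imports Defs
begin

text \<open>
  Cover \<open>D\<^sub>\<sigma> X\<close> by \<open>n\<close> unit balls with centres \<open>z\<^sub>i\<close>. On the part of \<open>X\<close> belonging to the \<open>i\<close>-th ball,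
  the map \<open>\<phi>\<^sub>i x = D\<^sub>\<sigma> x - z\<^sub>i\<close> takes values in the closed unit ball \<open>B\<close> and turns the isotropic kernel
  into the anisotropic one, because the Gaussian kernel is translation invariant. Hence the
  restriction of any \<open>f\<close> in the unit ball of \<open>H\<^sub>\<sigma>(X)\<close> to that part should be \<open>g \<circ> \<phi>\<^sub>i\<close> for some \<open>g\<close> in the
  unit ball of \<open>H\<^sub>1(B)\<close>. If \<open>m\<close> balls of \<open>\<ell>\<^sub>\<infinity>(B)\<close> cover the latter, then \<open>f\<close> is uniformly \<open>\<epsilon>\<close>-close to one
  of the \<open>m\<^sup>n\<close> functions that arise by choosing a centre independently on each part and gluing. Taking
  logarithms turns \<open>m\<^sup>n\<close> into the product on the right-hand side.

  An exact \<open>g\<close> would be obtained from a projection onto the closed span of kernel sections. It is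
  enough, and simpler, to have a sequence \<open>g\<^sub>k\<close> in the unit ball of \<open>H\<^sub>1(B)\<close> with \<open>g\<^sub>k \<circ> \<phi>\<^sub>i \<rightarrow> f\<close> pointwise:
  infinitely many \<open>g\<^sub>k\<close> lie in the same one of the \<open>m\<close> closed balls, and the estimate by \<open>\<epsilon>\<close> survives
  the limit (\<open>covering_number_patch\<close>). Such a sequence comes from near-minimizers of the quadratic
  functional whose exact minimizer would be the Riesz representative of \<open>f\<close> on the span of the
  sections at the points \<open>\<phi>\<^sub>i x\<close> (\<open>approximate_Riesz_representation\<close>,
  \<open>pointwise_limit_of_unit_ball\<close>).
\<close>


section \<open>Covering numbers\<close>

lemma covering_number_le:
  assumes "1 \<le> n" "\<And>i. i < n \<Longrightarrow> x i \<in> mspace E" "A \<subseteq> (\<Union>i<n. mcball_of E (x i) \<epsilon>)"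
  shows "covering_number E A \<epsilon> \<le> enat n"
  unfolding covering_number_def by (rule Inf_lower) (use assms in blast)

lemma covering_number_attained:
  assumes "covering_number E A \<epsilon> = enat n"
  obtains x where "1 \<le> n" "\<And>i. i < n \<Longrightarrow> x i \<in> mspace E" "A \<subseteq> (\<Union>i<n. mcball_of E (x i) \<epsilon>)"
proof -
  let ?S = "{enat n | n. 1 \<le> n \<and>
    (\<exists>x. (\<forall>i<n. x i \<in> mspace E) \<and> A \<subseteq> (\<Union>i<n. mcball_of E (x i) \<epsilon>))}"
  have Inf: "Inf ?S = enat n"
    using assms unfolding covering_number_def .
  then have "?S \<noteq> {}"
    unfolding Inf_enat_def by (auto split: if_splits)
  then have "Inf ?S \<in> ?S"
    unfolding Inf_enat_def by (smt (verit, best) LeastI ex_in_conv)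
  then show thesis
    unfolding Inf using that by auto
qed

lemma covering_number_ge_1: "1 \<le> covering_number E A \<epsilon>"
  unfolding covering_number_def by (rule Inf_greatest) (auto simp: one_enat_def)

lemma ln_enat_mono:
  assumes "1 \<le> a" "a \<le> b"
  shows "ln_enat a \<le> ln_enat b"
  using assms by (cases a; cases b) (auto simp: one_enat_def)

lemma covering_number_bounded_finite:
  fixes A :: "'a::euclidean_space set"
  assumes "bounded A" "0 < \<epsilon>"
  obtains n where "covering_number euclidean_metric A \<epsilon> = enat n"
proof -
  have "compact (closure A)"
    using assms(1) by simp
  then obtain K where K: "finite K" "closure A \<subseteq> (\<Union>x\<in>K. ball x \<epsilon>)"
    using assms(2) unfolding compact_eq_totally_bounded by blast
  have "finite (insert 0 K)"
    using K(1) by simp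
  then have "\<exists>n x. insert 0 K = x ` {i::nat. i < n}"
    unfolding finite_conv_nat_seg_image .
  then obtain n and x :: "nat \<Rightarrow> 'a" where x: "insert 0 K = x ` {i. i < n}"
    by blast
  have "A \<subseteq> (\<Union>i<n. mcball_of euclidean_metric (x i) \<epsilon>)"
  proof
    fix a assume "a \<in> A"
    then have "a \<in> (\<Union>x\<in>K. ball x \<epsilon>)"
      using K(2) closure_subset by blast
    then obtain y where y: "y \<in> K" "dist y a < \<epsilon>"
      by auto
    then obtain i where "i < n" "y = x i"
      using x by blast
    with y show "a \<in> (\<Union>i<n. mcball_of euclidean_metric (x i) \<epsilon>)"
      by (intro UN_I[of i]) auto
  qed
  moreover have "1 \<le> n"
    using x by (cases n) auto
  ultimately have "covering_number euclidean_metric A \<epsilon> \<le> enat n"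
    by (intro covering_number_le) auto
  then show thesis
    using that by (cases "covering_number euclidean_metric A \<epsilon>") auto
qed

lemma mspace_linf: "f \<in> mspace (linf X) \<longleftrightarrow> f \<in> extensional X \<and> (\<exists>C. \<forall>x\<in>X. \<bar>f x\<bar> \<le> C)"
  by (auto simp: linf_def Met_TC.fspace_def bounded_iff)

lemma in_mcball_linf:
  assumes "0 \<le> \<epsilon>"
  shows "g \<in> mcball_of (linf X) f \<epsilon> \<longleftrightarrow>
    f \<in> mspace (linf X) \<and> g \<in> mspace (linf X) \<and> (\<forall>x\<in>X. \<bar>f x - g x\<bar> \<le> \<epsilon>)"
proof (cases "f \<in> mspace (linf X) \<and> g \<in> mspace (linf X) \<and> X \<noteq> {}")
  case True
  then have fg: "f \<in> Met_TC.fspace X" "g \<in> Met_TC.fspace X" "X \<noteq> {}"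
    by (auto simp: linf_def)
  have "mdist (linf X) f g = (SUP x\<in>X. dist (f x) (g x))"
    using fg by (simp add: linf_def Met_TC.fdist_def)
  then show ?thesis
    using True fg cSUP_le_iff[OF fg(3) Met_TC.bdd_above_dist[OF fg]]
    by (simp add: dist_real_def)
next
  case False
  then show ?thesis
    using assms by (auto simp: linf_def)
qed

text \<open>
  The gluing argument. Each \<open>f\<close> looks, on the part \<open>P i\<close>, like a pointwise limit of members of \<open>G\<close>
  pulled back along \<open>\<phi> i\<close>; with \<open>m\<close> centres for \<open>G\<close> there are \<open>m ^ n\<close> ways of choosing one centre per
  part, and each choice glues to one centre for \<open>F\<close>. The parts may overlap, so the gluing uses a
  selection \<open>\<iota>\<close> of one part for every point.
\<close>

lemma covering_number_patch:
  fixes F :: "('a \<Rightarrow> real) set" and G :: "('b \<Rightarrow> real) set" and \<phi> :: "nat \<Rightarrow> 'a \<Rightarrow> 'b"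
  assumes "0 \<le> \<epsilon>" and F: "F \<subseteq> extensional X"
    and cover: "X \<subseteq> (\<Union>i<n. P i)"
    and \<phi>: "\<And>i. i < n \<Longrightarrow> \<phi> i ` (X \<inter> P i) \<subseteq> Y"
    and lift: "\<And>f i. f \<in> F \<Longrightarrow> i < n \<Longrightarrow>
      \<exists>g. range g \<subseteq> G \<and> (\<forall>x\<in>X \<inter> P i. (\<lambda>k::nat. g k (\<phi> i x)) \<longlonglongrightarrow> f x)"
    and m: "covering_number (linf Y) G \<epsilon> = enat m"
  shows "covering_number (linf X) F \<epsilon> \<le> enat (m ^ n)"
proof -
  obtain y where "1 \<le> m" and y: "\<And>j. j < m \<Longrightarrow> y j \<in> mspace (linf Y)"
      and G: "G \<subseteq> (\<Union>j<m. mcball_of (linf Y) (y j) \<epsilon>)"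
    using covering_number_attained[OF m] by blast
  define \<iota> where "\<iota> x = (SOME i. i < n \<and> x \<in> P i)" for x
  have \<iota>: "\<iota> x < n" "x \<in> P (\<iota> x)" if "x \<in> X" for x
    using someI_ex[of "\<lambda>i. i < n \<and> x \<in> P i"] cover that unfolding \<iota>_def by blast+
  define c where "c J = (\<lambda>x\<in>X. y (J (\<iota> x)) (\<phi> (\<iota> x) x))" for J :: "nat \<Rightarrow> nat"
  define \<J> where "\<J> = {..<n} \<rightarrow>\<^sub>E {..<m}"
  have c: "c J \<in> mspace (linf X)" if "J \<in> \<J>" for J
  proof -
    have J: "J i < m" if "i < n" for i
      using \<open>J \<in> \<J>\<close> that by (auto simp: \<J>_def PiE_iff)
    have "\<exists>C. \<forall>z\<in>Y. \<bar>y j z\<bar> \<le> C" if "j < m" for j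
      using y[OF that] by (simp add: mspace_linf)
    then obtain C where C: "\<And>j z. j < m \<Longrightarrow> z \<in> Y \<Longrightarrow> \<bar>y j z\<bar> \<le> C j"
      by metis
    have "\<bar>c J x\<bar> \<le> Max (C ` {..<m})" if "x \<in> X" for x
    proof -
      have j: "J (\<iota> x) < m"
        using J[OF \<iota>(1)[OF that]] .
      have "\<phi> (\<iota> x) x \<in> Y"
        using \<phi>[OF \<iota>(1)[OF that]] \<iota>(2)[OF that] that by blast
      then have "\<bar>c J x\<bar> \<le> C (J (\<iota> x))"
        using C[OF j] that by (simp add: c_def)
      also have "\<dots> \<le> Max (C ` {..<m})"
        using j by (intro Max_ge) auto
      finally show ?thesis .
    qed
    then show ?thesis
      by (auto simp: mspace_linf c_def)
  qed
  have covered: "\<exists>J\<in>\<J>. f \<in> mcball_of (linf X) (c J) \<epsilon>" if "f \<in> F" for f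
  proof -
    have "\<exists>j<m. \<forall>x\<in>X \<inter> P i. \<bar>y j (\<phi> i x) - f x\<bar> \<le> \<epsilon>" if i: "i < n" for i
    proof -
      obtain g where g: "range g \<subseteq> G"
          and lim: "\<And>x. x \<in> X \<inter> P i \<Longrightarrow> (\<lambda>k::nat. g k (\<phi> i x)) \<longlonglongrightarrow> f x"
        using lift[OF \<open>f \<in> F\<close> i] by auto
      have "\<exists>j<m. g k \<in> mcball_of (linf Y) (y j) \<epsilon>" for k
        using g G by blast
      then obtain j where j: "\<And>k. j k < m" "\<And>k. g k \<in> mcball_of (linf Y) (y (j k)) \<epsilon>"
        by metis
      \<comment> \<open>Finitely many closed balls: one of them contains a whole subsequence of \<open>g\<close>, so its centre is
        \<open>\<epsilon>\<close>-close also to the pointwise limit.\<close>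
      have "finite (range j)"
        using j(1) by (intro finite_subset[OF _ finite_lessThan[of m]]) auto
      then obtain k0 where inf: "infinite {k. j k = j k0}"
        using pigeonhole_infinite[of UNIV j] by auto
      have "\<bar>y (j k0) (\<phi> i x) - f x\<bar> \<le> \<epsilon>" if x: "x \<in> X \<inter> P i" for x
      proof (rule LIMSEQ_le_const2)
        let ?r = "enumerate {k. j k = j k0}"
        have "strict_mono ?r"
          using strict_mono_enumerate[OF inf] .
        then show "(\<lambda>k. \<bar>y (j k0) (\<phi> i x) - g (?r k) (\<phi> i x)\<bar>) \<longlonglongrightarrow> \<bar>y (j k0) (\<phi> i x) - f x\<bar>"
          using LIMSEQ_subseq_LIMSEQ[OF lim[OF x]]
          by (intro tendsto_intros) (simp add: o_def)
        have "\<bar>y (j k0) (\<phi> i x) - g (?r k) (\<phi> i x)\<bar> \<le> \<epsilon>" for k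
        proof -
          have "j (?r k) = j k0"
            using enumerate_in_set[OF inf] by simp
          then show ?thesis
            using j(2)[of "?r k"] \<phi>[OF i] x unfolding in_mcball_linf[OF assms(1)] by auto
        qed
        then show "\<exists>N. \<forall>k\<ge>N. \<bar>y (j k0) (\<phi> i x) - g (?r k) (\<phi> i x)\<bar> \<le> \<epsilon>"
          by blast
      qed
      then show ?thesis
        using j(1) by blast
    qed
    then obtain J0 where J0: "\<And>i. i < n \<Longrightarrow> J0 i < m"
        "\<And>i x. i < n \<Longrightarrow> x \<in> X \<inter> P i \<Longrightarrow> \<bar>y (J0 i) (\<phi> i x) - f x\<bar> \<le> \<epsilon>"
      by metis
    let ?J = "restrict J0 {..<n}"
    have J: "?J \<in> \<J>"
      using J0 by (auto simp: \<J>_def)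
    have close: "\<bar>c ?J x - f x\<bar> \<le> \<epsilon>" if "x \<in> X" for x
      using J0(2)[of "\<iota> x" x] \<iota>[OF that] that by (simp add: c_def)
    obtain C where "\<And>x. x \<in> X \<Longrightarrow> \<bar>c ?J x\<bar> \<le> C"
      using c[OF J] by (auto simp: mspace_linf)
    then have "\<forall>x\<in>X. \<bar>f x\<bar> \<le> C + \<epsilon>"
      using close by fastforce
    then have "f \<in> mspace (linf X)"
      using \<open>f \<in> F\<close> F by (auto simp: mspace_linf)
    then show ?thesis
      using J c[OF J] close in_mcball_linf[OF assms(1)] by blast
  qed
  have "finite \<J>" "card \<J> = m ^ n"
    by (simp_all add: \<J>_def finite_PiE card_PiE)
  then obtain b where b: "bij_betw b {..<m ^ n} \<J>"
    using ex_bij_betw_nat_finite[of \<J>] by (auto simp: atLeast0LessThan)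
  show ?thesis
  proof (rule covering_number_le)
    show "1 \<le> m ^ n"
      using \<open>1 \<le> m\<close> by simp
    show "c (b i) \<in> mspace (linf X)" if "i < m ^ n" for i
      using c b that by (auto simp: bij_betw_def)
    show "F \<subseteq> (\<Union>i<m ^ n. mcball_of (linf X) (c (b i)) \<epsilon>)"
    proof
      fix f assume "f \<in> F"
      then obtain J where "J \<in> \<J>" "f \<in> mcball_of (linf X) (c J) \<epsilon>"
        using covered by blast
      moreover from this obtain i where "i < m ^ n" "J = b i"
        using b by (auto simp: bij_betw_def)
      ultimately show "f \<in> (\<Union>i<m ^ n. mcball_of (linf X) (c (b i)) \<epsilon>)"
        by blast
    qed
  qed
qed


section \<open>Riesz representation on a subspace\<close>

lemma discriminant_le_zero:
  fixes a b c :: real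
  assumes "\<And>t. 0 \<le> a + 2 * t * b + t\<^sup>2 * c" "0 \<le> c"
  shows "b\<^sup>2 \<le> a * c"
proof (cases "c = 0")
  case True
  have "b = 0"
  proof (rule ccontr)
    assume "b \<noteq> 0"
    then have "a + 2 * (- (a + 1) / (2 * b)) * b = - 1"
      by (simp add: field_simps)
    then show False
      using assms(1)[of "- (a + 1) / (2 * b)"] True by simp
  qed
  then show ?thesis
    by (simp add: True)
next
  case False
  then have "0 < c"
    using assms(2) by simp
  then have "a + 2 * (- b / c) * b + (- b / c)\<^sup>2 * c = a - b\<^sup>2 / c"
    by (simp add: field_simps power2_eq_square)
  then have "b\<^sup>2 / c \<le> a"
    using assms(1)[of "- b / c"] by simp
  then show ?thesis
    using \<open>0 < c\<close> by (simp add: field_simps)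
qed

context hilbert_function_space
begin

text \<open>
  The vector space operations as constants of their own, so that bilinearity can be used as a set
  of first-order rewrite rules.
\<close>

definition fadd :: "('a \<Rightarrow> real) \<Rightarrow> ('a \<Rightarrow> real) \<Rightarrow> 'a \<Rightarrow> real" where
  "fadd f g = (\<lambda>x\<in>X. f x + g x)"

definition fscale :: "real \<Rightarrow> ('a \<Rightarrow> real) \<Rightarrow> 'a \<Rightarrow> real" where
  "fscale c f = (\<lambda>x\<in>X. c * f x)"

lemma closed [simp]:
  assumes "f \<in> H"
  shows "fscale c f \<in> H" "g \<in> H \<Longrightarrow> fadd f g \<in> H"
  using assms by (simp_all add: fscale_def fadd_def scale_closed add_closed del: restrict_apply)

lemma ip_left [simp]:
  assumes "f \<in> H" "h \<in> H"
  shows "ip (fscale c f) h = c * ip f h"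
    and "g \<in> H \<Longrightarrow> ip (fadd f g) h = ip f h + ip g h"
  using assms by (simp_all add: fscale_def fadd_def ip_scale_left ip_add_left del: restrict_apply)

lemma ip_right [simp]:
  assumes "f \<in> H" "h \<in> H"
  shows "ip h (fscale c f) = c * ip h f"
    and "g \<in> H \<Longrightarrow> ip h (fadd f g) = ip h f + ip h g"
  using assms by (simp_all add: ip_commute[of h])

lemma ip_zero_right:
  assumes "f \<in> H"
  shows "ip f (\<lambda>x\<in>X. 0) = 0"
proof -
  have "(\<lambda>x\<in>X. 0) = fscale 0 f"
    by (auto simp: fscale_def)
  then show ?thesis
    using assms by simp
qed

lemma Cauchy_Schwarz:
  assumes "f \<in> H" "g \<in> H"
  shows "(ip f g)\<^sup>2 \<le> ip f f * ip g g"
proof (rule discriminant_le_zero)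
  show "0 \<le> ip f f + 2 * t * ip f g + t\<^sup>2 * ip g g" for t
    using ip_nonneg[of "fadd f (fscale t g)"] assms ip_commute[of g f]
    by (simp add: algebra_simps power2_eq_square)
qed (use assms ip_nonneg in auto)

lemma ip_norm_nonneg: "0 \<le> ip_norm ip f" if "f \<in> H"
  using ip_nonneg[OF that] by (simp add: ip_norm_def)

lemma ip_norm_sq: "(ip_norm ip f)\<^sup>2 = ip f f" if "f \<in> H"
  using ip_nonneg[OF that] by (simp add: ip_norm_def)

lemma abs_ip_le: "\<bar>ip f g\<bar> \<le> ip_norm ip f * ip_norm ip g" if "f \<in> H" "g \<in> H"
  using Cauchy_Schwarz[OF that] unfolding ip_norm_def real_sqrt_mult[symmetric]
  by (rule real_le_rsqrt[of "\<bar>ip f g\<bar>", simplified])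

text \<open>
  The set \<open>R\<close> is the graph of a linear functional on a subspace, bounded by \<open>C\<close>. Its Riesz
  representative is the minimizer of \<open>\<parallel>u\<parallel>\<^sup>2 - 2 a\<close> over \<open>(u, a) \<in> R\<close>, which need not exist in the
  subspace. A point within \<open>\<delta>\<close> of the infimum represents the functional approximately: moving from it
  in any direction \<open>(v, b)\<close> lowers the value by at most \<open>\<delta>\<close>, and a discriminant turns this into the
  stated bound.
\<close>

lemma approximate_Riesz_representation:
  assumes R: "R \<subseteq> H \<times> UNIV" "R \<noteq> {}"
    and add: "\<And>u a v b. (u, a) \<in> R \<Longrightarrow> (v, b) \<in> R \<Longrightarrow> (fadd u v, a + b) \<in> R"
    and scale: "\<And>u a c. (u, a) \<in> R \<Longrightarrow> (fscale c u, c * a) \<in> R"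
    and bound: "\<And>u a. (u, a) \<in> R \<Longrightarrow> \<bar>a\<bar> \<le> C * ip_norm ip u"
    and "0 < \<delta>"
  obtains u a where "(u, a) \<in> R" "\<And>v b. (v, b) \<in> R \<Longrightarrow> (ip u v - b)\<^sup>2 \<le> \<delta> * ip v v"
proof -
  define J where "J = (\<lambda>(u, a). ip u u - 2 * a)"
  have "- C\<^sup>2 \<le> J p" if "p \<in> R" for p
  proof -
    obtain u a where p: "p = (u, a)"
      by force
    then have u: "u \<in> H"
      using that R by auto
    have "0 \<le> (ip_norm ip u - C)\<^sup>2"
      by simp
    also have "\<dots> = ip u u - 2 * (C * ip_norm ip u) + C\<^sup>2"
      using u by (simp add: power2_diff ip_norm_sq)
    also have "\<dots> \<le> J p + C\<^sup>2"
      using bound[of u a] that p by (auto simp: J_def)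
    finally show ?thesis
      by simp
  qed
  then have bdd: "bdd_below (J ` R)"
    by (intro bdd_belowI2)
  obtain u a where ua: "(u, a) \<in> R" "J (u, a) < Inf (J ` R) + \<delta>"
    using cInf_lessD[of "J ` R" "Inf (J ` R) + \<delta>"] R(2) \<open>0 < \<delta>\<close> by auto
  have "(ip u v - b)\<^sup>2 \<le> \<delta> * ip v v" if vb: "(v, b) \<in> R" for v b
  proof (rule discriminant_le_zero)
    have H: "u \<in> H" "v \<in> H"
      using ua vb R by auto
    show "0 \<le> ip v v"
      using H ip_nonneg by simp
    fix t :: real
    have "Inf (J ` R) \<le> J (fadd u (fscale t v), a + t * b)"
      using ua vb add scale by (intro cInf_lower bdd) auto
    also have "\<dots> = J (u, a) + 2 * t * (ip u v - b) + t\<^sup>2 * ip v v"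
      using H ip_commute[of v u] by (simp add: J_def algebra_simps power2_eq_square)
    finally show "0 \<le> \<delta> + 2 * t * (ip u v - b) + t\<^sup>2 * ip v v"
      using ua by simp
  qed
  with ua show thesis
    using that by blast
qed

end


section \<open>Kernel-preserving maps between reproducing kernel Hilbert spaces\<close>

locale kernel_preserving_map =
  S: rkhs X k H ip + T: rkhs Y l G jp
  for X :: "'a set" and k H ip and Y :: "'b set" and l G jp +
  fixes A :: "'a set" and \<phi> :: "'a \<Rightarrow> 'b"
  assumes subset: "A \<subseteq> X" and maps_into: "x \<in> A \<Longrightarrow> \<phi> x \<in> Y"
    and kernel_eq: "\<lbrakk>x \<in> A; x' \<in> A\<rbrakk> \<Longrightarrow> l (\<phi> x) (\<phi> x') = k x x'"
begin

text \<open>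
  The graph of the isometry between the spans of the kernel sections at \<open>A\<close> and at \<open>\<phi> ` A\<close> that sends the
  section at \<open>x\<close> to the section at \<open>\<phi> x\<close>. As a relation it requires no argument that the image of
  a linear combination is independent of how the combination is written.
\<close>

inductive matched :: "('a \<Rightarrow> real) \<Rightarrow> ('b \<Rightarrow> real) \<Rightarrow> bool" where
  zero: "matched (\<lambda>x\<in>X. 0) (\<lambda>y\<in>Y. 0)"
| kernel: "x \<in> A \<Longrightarrow> matched (\<lambda>z\<in>X. k z x) (\<lambda>y\<in>Y. l y (\<phi> x))"
| add: "matched s u \<Longrightarrow> matched s' u' \<Longrightarrow> matched (S.fadd s s') (T.fadd u u')"
| scale: "matched s u \<Longrightarrow> matched (S.fscale c s) (T.fscale c u)"

lemma matched_in: "s \<in> H" "u \<in> G" if "matched s u"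
  using that subset
  by (induction) (auto simp: S.zero_closed T.zero_closed S.kernel_section T.kernel_section maps_into)

lemma matched_agree: "u (\<phi> x) = s x" if "matched s u" "x \<in> A"
  using that subset maps_into
  by (induction) (auto simp: S.fadd_def T.fadd_def S.fscale_def T.fscale_def kernel_eq subset_iff)

text \<open>
  Pairing with a kernel section is evaluation, and matched functions have equal values at \<open>x\<close> and
  \<open>\<phi> x\<close>; bilinearity does the rest.
\<close>

lemma matched_isometry: "jp u u' = ip s s'" if "matched s' u'" "matched s u"
  using that
proof induction
  case (kernel x)
  then show ?case
    using subset maps_into matched_in[of s u] matched_agree
    by (simp add: S.reproducing T.reproducing subset_iff del: restrict_apply)
qed (simp_all add: matched_in S.ip_zero_right T.ip_zero_right)

text \<open>
  Pairing with \<open>f\<close> is a functional of norm at most 1 on the span of the sections at \<open>A\<close>; carried over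
  by the isometry \<open>matched\<close>, it becomes a functional on the span of the sections at \<open>\<phi> ` A\<close>. An
  approximate representative \<open>u\<close> of it is the desired function: testing \<open>u\<close> against the section at
  \<open>\<phi> x\<close> compares \<open>u (\<phi> x)\<close> with \<open>f x\<close> by the reproducing properties, and testing it against itself
  bounds its norm.
\<close>

lemma approximate_lift:
  assumes f: "f \<in> H" "ip_norm ip f \<le> 1" and "0 < \<eta>"
  obtains u where "u \<in> G" "ip_norm jp u \<le> 1 + \<eta>"
    "\<And>x. x \<in> A \<Longrightarrow> \<bar>u (\<phi> x) - f x\<bar> \<le> \<eta> * sqrt (k x x)"
proof -
  define R where "R = {(u, ip f s) | s u. matched s u}"
  have bound: "\<bar>a\<bar> \<le> 1 * ip_norm jp u" if ua: "(u, a) \<in> R" for u a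
  proof -
    obtain s where s: "matched s u" "a = ip f s"
      using ua unfolding R_def by blast
    have "\<bar>a\<bar> \<le> ip_norm ip f * ip_norm ip s"
      using s f S.abs_ip_le matched_in by simp
    also have "\<dots> \<le> 1 * ip_norm ip s"
      using f s matched_in S.ip_norm_nonneg by (intro mult_right_mono) auto
    also have "ip_norm ip s = ip_norm jp u"
      using s matched_isometry[of s u s u] by (simp add: ip_norm_def)
    finally show ?thesis .
  qed
  obtain u a where ua: "(u, a) \<in> R"
    and near: "\<And>v b. (v, b) \<in> R \<Longrightarrow> (jp u v - b)\<^sup>2 \<le> \<eta>\<^sup>2 * jp v v"
  proof (rule T.approximate_Riesz_representation)
    show "\<bar>a\<bar> \<le> 1 * ip_norm jp u" if "(u, a) \<in> R" for u a
      using bound[OF that] .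
    show "R \<subseteq> G \<times> UNIV" "R \<noteq> {}" "0 < \<eta>\<^sup>2"
      using matched_in matched.zero \<open>0 < \<eta>\<close> by (auto simp: R_def)
    show "(T.fadd u v, a + b) \<in> R" if "(u, a) \<in> R" "(v, b) \<in> R" for u a v b
      using that f matched_in matched.add unfolding R_def
      by clarsimp (metis S.ip_right(2))
    show "(T.fscale c u, c * a) \<in> R" if "(u, a) \<in> R" for u a c
      using that f matched_in matched.scale unfolding R_def
      by clarsimp (metis S.ip_right(1))
  qed (rule that)
  then have u: "u \<in> G"
    using matched_in by (auto simp: R_def)
  \<comment> \<open>Here \<open>u\<close> is tested against itself.\<close>
  have "ip_norm jp u * ip_norm jp u \<le> (1 + \<eta>) * ip_norm jp u"
  proof -
    have "(ip_norm jp u * ip_norm jp u - a)\<^sup>2 \<le> (\<eta> * ip_norm jp u)\<^sup>2"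
      using near[OF ua] unfolding T.ip_norm_sq[OF u, symmetric]
      by (simp add: power_mult_distrib flip: power2_eq_square)
    then have "\<bar>ip_norm jp u * ip_norm jp u - a\<bar> \<le> \<eta> * ip_norm jp u"
      using \<open>0 < \<eta>\<close> T.ip_norm_nonneg[OF u] by (simp add: abs_le_square_iff[symmetric])
    then show ?thesis
      using bound[OF ua] by (simp add: algebra_simps)
  qed
  then have "ip_norm jp u \<le> 1 + \<eta>"
    using T.ip_norm_nonneg[OF u] \<open>0 < \<eta>\<close> by (cases "ip_norm jp u = 0") auto
  moreover have "\<bar>u (\<phi> x) - f x\<bar> \<le> \<eta> * sqrt (k x x)" if "x \<in> A" for x
  proof -
    have x: "x \<in> X" "\<phi> x \<in> Y"
      using that subset maps_into by auto
    have "((\<lambda>y\<in>Y. l y (\<phi> x)), f x) \<in> R"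
      using matched.kernel[OF that] S.reproducing[OF f(1) x(1)] unfolding R_def by force
    \<comment> \<open>Here \<open>u\<close> is tested against the section at \<open>\<phi> x\<close>, whose squared norm is \<open>l (\<phi> x) (\<phi> x) = k x x\<close>.\<close>
    from near[OF this] have "(u (\<phi> x) - f x)\<^sup>2 \<le> \<eta>\<^sup>2 * k x x"
      using x that u by (simp add: T.reproducing T.kernel_section kernel_eq)
    then show ?thesis
      using \<open>0 < \<eta>\<close> real_sqrt_le_mono by (fastforce simp: real_sqrt_mult)
  qed
  ultimately show thesis
    using that u by blast
qed

text \<open>
  Dividing the approximate lifts by \<open>1 + \<eta>\<close> puts them into the unit ball and keeps their pointwise
  limit as \<open>\<eta> \<rightarrow> 0\<close>.
\<close>

lemma pointwise_limit_of_unit_ball: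
  assumes f: "f \<in> H" "ip_norm ip f \<le> 1"
  shows "\<exists>g. range g \<subseteq> {u \<in> G. ip_norm jp u \<le> 1} \<and>
    (\<forall>x\<in>A. (\<lambda>n::nat. g n (\<phi> x)) \<longlonglongrightarrow> f x)"
proof -
  let ?\<eta> = "\<lambda>n. inverse (real (Suc n))"
  have "\<exists>u. u \<in> G \<and> ip_norm jp u \<le> 1 + ?\<eta> n \<and>
      (\<forall>x\<in>A. \<bar>u (\<phi> x) - f x\<bar> \<le> ?\<eta> n * sqrt (k x x))" for n
    by (rule approximate_lift[OF f, of "?\<eta> n"]) auto
  then obtain u where u: "\<And>n. u n \<in> G" "\<And>n. ip_norm jp (u n) \<le> 1 + ?\<eta> n"
    "\<And>n x. x \<in> A \<Longrightarrow> \<bar>u n (\<phi> x) - f x\<bar> \<le> ?\<eta> n * sqrt (k x x)"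
    by metis
  let ?g = "\<lambda>n. T.fscale (1 / (1 + ?\<eta> n)) (u n)"
  have pos: "0 < 1 + ?\<eta> n" for n
    by (simp add: add_pos_pos)
  have "ip_norm jp (?g n) \<le> 1" for n
  proof -
    have "ip_norm jp (?g n) = 1 / (1 + ?\<eta> n) * ip_norm jp (u n)"
      using u(1) pos[of n] by (simp add: ip_norm_def real_sqrt_mult real_sqrt_divide)
    also have "\<dots> \<le> 1"
      using u(2)[of n] pos[of n] by (simp only: times_divide_eq_left mult_1 divide_le_eq_1_pos)
    finally show ?thesis .
  qed
  then have "range ?g \<subseteq> {u \<in> G. ip_norm jp u \<le> 1}"
    using u(1) by auto
  moreover have "(\<lambda>n. ?g n (\<phi> x)) \<longlonglongrightarrow> f x" if "x \<in> A" for x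
  proof -
    have "(\<lambda>n. ?\<eta> n * sqrt (k x x)) \<longlonglongrightarrow> 0"
      by (rule tendsto_mult_left_zero[OF LIMSEQ_inverse_real_of_nat])
    then have "(\<lambda>n. u n (\<phi> x) - f x) \<longlonglongrightarrow> 0"
      by (rule Lim_null_comparison[rotated])
        (unfold real_norm_def, rule always_eventually, use u(3)[OF that] in blast)
    then have "(\<lambda>n. u n (\<phi> x)) \<longlonglongrightarrow> f x"
      by (simp add: LIM_zero_iff)
    then have "(\<lambda>n. 1 / (1 + ?\<eta> n) * u n (\<phi> x)) \<longlonglongrightarrow> 1 / (1 + 0) * f x"
      by (intro tendsto_intros LIMSEQ_inverse_real_of_nat) auto
    then show ?thesis
      using maps_into[OF that] by (simp add: T.fscale_def)
  qed
  ultimately show ?thesis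
    by (intro exI[of _ ?g] conjI ballI)
qed

end


section \<open>Gaussian kernels\<close>

lemma gauss_kernel_translate_diag_scale:
  "gauss_kernel (diag_scale \<sigma> x - z) (diag_scale \<sigma> y - z) = aniso_gauss_kernel \<sigma> x y"
  by (simp add: gauss_kernel_def aniso_gauss_kernel_def)

lemma bounded_diag_scale:
  assumes "bounded X"
  shows "bounded (diag_scale \<sigma> ` X)"
proof -
  have "linear (diag_scale \<sigma>)"
    by (rule linearI) (simp_all add: diag_scale_def vec_eq_iff algebra_simps)
  then show ?thesis
    using assms by (simp add: bounded_linear_image linear_conv_bounded_linear)
qed

theorem theorem2p4:
  fixes X :: "(real ^ 'n) set" and \<sigma> :: "real ^ 'n" and \<epsilon> :: real
    and H H1 :: "(real ^ 'n \<Rightarrow> real) set"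
    and ip ip1 :: "(real ^ 'n \<Rightarrow> real) \<Rightarrow> (real ^ 'n \<Rightarrow> real) \<Rightarrow> real"
  assumes "bounded X"
    and "\<forall>i. 0 < \<sigma> $ i"
    and "0 < \<epsilon>" and "\<epsilon> \<le> 1"
    and "rkhs X (aniso_gauss_kernel \<sigma>) H ip"
    and "rkhs (cball 0 1) gauss_kernel H1 ip1"
  shows "log_covering_number id H (ip_norm ip) (linf X) \<epsilon>
    \<le> ereal_of_enat (covering_number euclidean_metric (diag_scale \<sigma> ` X) 1)
      * log_covering_number id H1 (ip_norm ip1) (linf (cball 0 1)) \<epsilon>"
proof -
  let ?F = "{f \<in> H. ip_norm ip f \<le> 1}" and ?G = "{g \<in> H1. ip_norm ip1 g \<le> 1}"
  obtain n where n: "covering_number euclidean_metric (diag_scale \<sigma> ` X) 1 = enat n"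
    using covering_number_bounded_finite[OF bounded_diag_scale[OF assms(1)]] by (metis zero_less_one)
  then obtain z where "1 \<le> n"
      and z: "diag_scale \<sigma> ` X \<subseteq> (\<Union>i<n. mcball_of euclidean_metric (z i) 1)"
    using covering_number_attained[OF n] by blast
  show ?thesis
  proof (cases "covering_number (linf (cball 0 1)) ?G \<epsilon>")
    case (enat m)
    let ?P = "\<lambda>i. {x. dist (z i) (diag_scale \<sigma> x) \<le> 1}"
    let ?\<phi> = "\<lambda>i x. diag_scale \<sigma> x - z i"
    have "1 \<le> m"
      using covering_number_ge_1[of "linf (cball 0 1)" ?G \<epsilon>] enat by (simp add: one_enat_def)
    have "covering_number (linf X) ?F \<epsilon> \<le> enat (m ^ n)"
    proof (rule covering_number_patch[where P = ?P and \<phi> = ?\<phi>, OF _ _ _ _ _ enat])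
      interpret rkhs X "aniso_gauss_kernel \<sigma>" H ip by fact
      show "?F \<subseteq> extensional X"
        using functions_on by blast
      show "X \<subseteq> (\<Union>i<n. ?P i)"
        using z by (fastforce simp: subset_iff)
      show "?\<phi> i ` (X \<inter> ?P i) \<subseteq> cball 0 1" for i
        by (auto simp: dist_norm norm_minus_commute)
      fix f i assume f: "f \<in> ?F"
      interpret kernel_preserving_map X "aniso_gauss_kernel \<sigma>" H ip
          "cball 0 1" gauss_kernel H1 ip1 "X \<inter> ?P i" "?\<phi> i"
        by (intro kernel_preserving_map.intro kernel_preserving_map_axioms.intro assms)
          (auto simp: gauss_kernel_translate_diag_scale dist_norm norm_minus_commute)
      show "\<exists>g. range g \<subseteq> ?G \<and>
          (\<forall>x\<in>X \<inter> ?P i. (\<lambda>k::nat. g k (?\<phi> i x)) \<longlonglongrightarrow> f x)"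
        by (rule pointwise_limit_of_unit_ball) (use f in simp_all)
    qed (use assms in simp)
    then have "ln_enat (covering_number (linf X) ?F \<epsilon>) \<le> ln_enat (enat (m ^ n))"
      by (intro ln_enat_mono covering_number_ge_1)
    then show ?thesis
      using \<open>1 \<le> m\<close> by (simp add: log_covering_number_def n enat ln_realpow)
  next
    case infinity
    \<comment> \<open>The right-hand side is \<open>n * \<infinity>\<close>, which is \<open>\<infinity>\<close> because \<open>n\<close> is positive; \<open>0 * \<infinity>\<close> would be \<open>0\<close>.\<close>
    then show ?thesis
      using \<open>1 \<le> n\<close> by (simp add: log_covering_number_def n)
  qed
qed

end
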